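(* Let $X$ be a smooth Banach space, let $\alpha\in\mathbb{R}$, let $A:X\rightrightarrows X^*$ be $\alpha$-monotone and let $\gamma>0$. Then the following hold: (1) For all $(x,a),(y,b)\in\mathrm{gra}\,J_{\gamma A}$, $$\langle Jx-Jy,a-b\rangle\ge(1+\gamma\alpha)\langle a-b,Ja-Jb\rangle.$$ (2) If $J_{\gamma A}$ is single-valued, then for all $x,y\in\mathrm{dom}\,J_{\gamma A}$, $$\langle Jx-Jy,J_{\gamma A}x-J_{\gamma A}y\rangle\ge(1+\gamma\alpha)\langle J_{\gamma A}x-J_{\gamma A}y,\,JJ_{\gamma A}x-JJ_{\gamma A}y\rangle,$$ i.e., $J_{\gamma A}$ is $(1+\gamma\alpha)$-firmly nonexpansive-type.
   Context: All Banach spaces are real. $J:X\to X^*$ is the normalized duality mapping, $\langle x,Jx\rangle=\|x\|^2=\|Jx\|^2$ (single-valued since $X$ is smooth); the duality pairing is written in either order. $A$ is $\alpha$-monotone if $\langle x-y,u-v\rangle\ge\alpha\langle x-y,Jx-Jy\rangle$ for all $(x,u),(y,v)\in\mathrm{gra}\,A$, where $\mathrm{gra}\,A=\{(x,u):u\in Ax\}$. The resolvent is $J_{\gamma A}:=(J+\gamma A)^{-1}J:X\rightrightarrows X$, i.e. $a\in J_{\gamma A}x$ iff $Jx\in Ja+\gamma Aa$; $\mathrm{dom}\,J_{\gamma A}=\{x:J_{\gamma A}x\ne\emptyset\}$. An operator $T:X\rightrightarrows X$ is $\sigma$-firmly nonexpansive-type if $\sigma>0$ and $\langle Jx-Jy,u-v\rangle\ge\sigma\langle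 u-v,Ju-Jv\rangle$ for all $(x,u),(y,v)\in\mathrm{gra}\,T$.
   Formalization: The claim that the resolvent is (1+γα)-firmly nonexpansive-type is stated only when 1+γα>0, since that notion requires a positive constant (A=0, α=-2, γ=1 in a Hilbert space violates it); the inequality itself is proved for all real α. *)

theory Defs
  imports "HOL-Analysis.Analysis"
begin

text \<open>
  A real Banach space is a type \<open>'a::banach\<close>; its dual is the library type
  \<open>'a \<Rightarrow>\<^sub>L real\<close> of bounded linear functionals with the operator norm.  Set-valued
  operators are functions into sets.
\<close>

abbreviation pairing :: "'a::real_normed_vector \<Rightarrow> ('a \<Rightarrow>\<^sub>L real) \<Rightarrow> real"
    (\<open>\<langle>_, _\<rangle>\<close>)
  where "\<langle>x, f\<rangle> \<equiv> blinfun_apply f x"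

text \<open>Smoothness: the norm is Gateaux differentiable on the unit sphere.\<close>

definition smooth_space :: "'a::real_normed_vector itself \<Rightarrow> bool" where
  "smooth_space _ \<longleftrightarrow>
     (\<forall>x y::'a. norm x = 1 \<longrightarrow> norm y = 1 \<longrightarrow>
        (\<exists>l::real. ((\<lambda>t. (norm (x + t *\<^sub>R y) - norm x) / t) \<longlongrightarrow> l) (at 0)))"

text \<open>
  The normalized duality mapping.  The definite description is meaningful on smooth spaces;
  see \<open>duality_map_ex1\<close> and \<open>duality_map\<close> below.
\<close>

definition duality_map :: "'a::real_normed_vector \<Rightarrow> ('a \<Rightarrow>\<^sub>L real)" where
  "duality_map x = (THE f. \<langle>x, f\<rangle> = (norm x)\<^sup>2 \<and> (norm f)\<^sup>2 = (norm x)\<^sup>2)"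

definition gra :: "('a \<Rightarrow> 'b set) \<Rightarrow> ('a \<times> 'b) set" where
  "gra T = {(x, u). u \<in> T x}"

definition op_dom :: "('a \<Rightarrow> 'b set) \<Rightarrow> 'a set" where
  "op_dom T = {x. T x \<noteq> {}}"

definition alpha_monotone ::
    "real \<Rightarrow> ('a::real_normed_vector \<Rightarrow> ('a \<Rightarrow>\<^sub>L real) set) \<Rightarrow> bool" where
  "alpha_monotone \<alpha> A \<longleftrightarrow>
     (\<forall>(x, u) \<in> gra A. \<forall>(y, v) \<in> gra A.
        \<langle>x - y, u - v\<rangle> \<ge> \<alpha> * \<langle>x - y, duality_map x - duality_map y\<rangle>)"

definition resolvent ::
    "real \<Rightarrow> ('a::real_normed_vector \<Rightarrow> ('a \<Rightarrow>\<^sub>L real) set) \<Rightarrow> 'a \<Rightarrow> 'a set" where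
  "resolvent \<gamma> A x = {a. duality_map x \<in> {duality_map a + \<gamma> *\<^sub>R u | u. u \<in> A a}}"

definition firmly_nonexpansive_type ::
    "real \<Rightarrow> ('a::real_normed_vector \<Rightarrow> 'a set) \<Rightarrow> bool" where
  "firmly_nonexpansive_type \<sigma> T \<longleftrightarrow>
     \<sigma> > 0 \<and>
     (\<forall>(x, u) \<in> gra T. \<forall>(y, v) \<in> gra T.
        \<langle>u - v, duality_map x - duality_map y\<rangle>
          \<ge> \<sigma> * \<langle>u - v, duality_map u - duality_map v\<rangle>)"


subsection \<open>The duality mapping of a smooth space is well defined\<close>

lemma smooth_space_quotient:
  fixes x y :: "'a::real_normed_vector"
  assumes "smooth_space TYPE('a)" and x: "norm x = 1"
  shows "\<exists>l. ((\<lambda>t. (norm (x + t *\<^sub>R y) - 1) / t) \<longlongrightarrow> l) (at 0)"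
proof (cases "y = 0")
  case True
  then show ?thesis using x by auto
next
  case False
  define n where "n = norm y"
  have n: "n > 0" using False by (simp add: n_def)
  have "norm (y /\<^sub>R n) = 1" using n by (simp add: n_def)
  then obtain l where
    "((\<lambda>t. (norm (x + t *\<^sub>R (y /\<^sub>R n)) - norm x) / t) \<longlongrightarrow> l) (at 0)"
    using assms unfolding smooth_space_def by blast
  then have "((\<lambda>t. (norm (x + (n * t) *\<^sub>R (y /\<^sub>R n)) - norm x) / (n * t)) \<longlongrightarrow> l) (at 0)"
    by (rule tendsto_compose_eventually[where g = "\<lambda>t. (norm (x + t *\<^sub>R (y /\<^sub>R n)) - norm x) / t"])
       (use n in \<open>auto intro!: tendsto_eq_intros simp: eventually_at_filter\<close>)
  then have "((\<lambda>t. n * ((norm (x + (n * t) *\<^sub>R (y /\<^sub>R n)) - norm x) / (n * t))) \<longlongrightarrow> n * l) (at 0)"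
    by (intro tendsto_intros)
  moreover have "(\<lambda>t. n * ((norm (x + (n * t) *\<^sub>R (y /\<^sub>R n)) - norm x) / (n * t)))
      = (\<lambda>t. (norm (x + t *\<^sub>R y) - 1) / t)"
    using n x by (simp add: fun_eq_iff mult.commute[of n] mult.assoc)
  ultimately show ?thesis by auto
qed

lemma unit_support_unique:
  fixes x :: "'a::real_normed_vector" and f :: "'a \<Rightarrow>\<^sub>L real"
  assumes x: "norm x = 1" and fx: "\<langle>x, f\<rangle> = 1" and nf: "norm f = 1"
    and l: "((\<lambda>t. (norm (x + t *\<^sub>R y) - 1) / t) \<longlongrightarrow> l) (at 0)"
  shows "\<langle>y, f\<rangle> = l"
proof -
  have le: "t * \<langle>y, f\<rangle> \<le> norm (x + t *\<^sub>R y) - 1" for t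
    using norm_blinfun[of f "x + t *\<^sub>R y"] fx nf
    by (simp add: blinfun.add_right blinfun.scaleR_right)
  have "((\<lambda>t. (norm (x + t *\<^sub>R y) - 1) / t) \<longlongrightarrow> l) (at_right 0)"
    using l by (rule filterlim_mono) (auto simp: at_le)
  moreover have "\<forall>\<^sub>F t in at_right 0. \<langle>y, f\<rangle> \<le> (norm (x + t *\<^sub>R y) - 1) / t"
    unfolding eventually_at_right_field
    by (rule exI[of _ 1]) (use le in \<open>auto simp: field_simps\<close>)
  ultimately have 1: "\<langle>y, f\<rangle> \<le> l"
    by (rule tendsto_lowerbound) simp
  have "((\<lambda>t. (norm (x + t *\<^sub>R y) - 1) / t) \<longlongrightarrow> l) (at_left 0)"
    using l by (rule filterlim_mono) (auto simp: at_le)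
  moreover have "\<forall>\<^sub>F t in at_left 0. (norm (x + t *\<^sub>R y) - 1) / t \<le> \<langle>y, f\<rangle>"
    unfolding eventually_at_left_field
    by (rule exI[of _ "-1"]) (use le in \<open>auto simp: field_simps\<close>)
  ultimately have "l \<le> \<langle>y, f\<rangle>"
    by (rule tendsto_upperbound) simp
  with 1 show ?thesis by simp
qed

lemma unit_support_exists:
  fixes x :: "'a::real_normed_vector"
  assumes sm: "smooth_space TYPE('a)" and x: "norm x = 1"
  shows "\<exists>f::'a \<Rightarrow>\<^sub>L real. \<langle>x, f\<rangle> = 1 \<and> norm f = 1"
proof -
  define q where "q = (\<lambda>y t. (norm (x + t *\<^sub>R y) - 1) / t)"
  obtain g where g: "\<And>y. (q y \<longlongrightarrow> g y) (at 0)"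
    using smooth_space_quotient[OF sm x] unfolding q_def by metis
  have uniq: "g y = l" if "(q y \<longlongrightarrow> l) (at 0)" for y l
    using tendsto_unique[OF _ g that] by simp
  have comp: "((\<lambda>t. q y (c * t)) \<longlongrightarrow> g y) (at 0)" if "c \<noteq> 0" for y c
    by (rule tendsto_compose_eventually[OF g])
       (use that in \<open>auto intro!: tendsto_eq_intros simp: eventually_at_filter\<close>)
  have scale: "g (c *\<^sub>R y) = c * g y" for c y
  proof (cases "c = 0")
    case True
    then show ?thesis using x by (auto intro!: uniq simp: q_def)
  next
    case False
    have "((\<lambda>t. c * q y (c * t)) \<longlongrightarrow> c * g y) (at 0)"
      by (intro tendsto_intros comp False)
    moreover have "(\<lambda>t. c * q y (c * t)) = q (c *\<^sub>R y)"
      using False by (auto simp: q_def fun_eq_iff mult.commute)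
    ultimately show ?thesis by (intro uniq) simp
  qed
  have sub: "g (y + z) \<le> g y + g z" for y z
  proof -
    have right: "(h \<longlongrightarrow> l) (at_right 0)" if "(h \<longlongrightarrow> l) (at 0)" for h :: "real \<Rightarrow> real" and l
      using that by (rule filterlim_mono) (auto simp: at_le)
    have lim: "((\<lambda>t. q y (2 * t) + q z (2 * t)) \<longlongrightarrow> g y + g z) (at_right 0)"
      by (intro right tendsto_intros comp) auto
    have "\<forall>\<^sub>F t in at_right 0. q (y + z) t \<le> q y (2 * t) + q z (2 * t)"
      unfolding eventually_at_right_field
    proof (intro exI[of _ 1] conjI allI impI)
      fix t :: real assume t: "0 < t"
      have "(x + (2 * t) *\<^sub>R y) + (x + (2 * t) *\<^sub>R z) = 2 *\<^sub>R (x + t *\<^sub>R (y + z))"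
        by (simp add: algebra_simps scaleR_2)
      then have "2 * norm (x + t *\<^sub>R (y + z)) \<le> norm (x + (2 * t) *\<^sub>R y) + norm (x + (2 * t) *\<^sub>R z)"
        using norm_triangle_ineq[of "x + (2 * t) *\<^sub>R y" "x + (2 * t) *\<^sub>R z"] by simp
      then have "(2 * norm (x + t *\<^sub>R (y + z)) - 2) / (2 * t)
          \<le> (norm (x + (2 * t) *\<^sub>R y) + norm (x + (2 * t) *\<^sub>R z) - 2) / (2 * t)"
        using t by (intro divide_right_mono) auto
      moreover have "(2 * norm (x + t *\<^sub>R (y + z)) - 2) / (2 * t) = q (y + z) t"
        unfolding q_def using t by (simp add: diff_divide_distrib)
      moreover have "(norm (x + (2 * t) *\<^sub>R y) + norm (x + (2 * t) *\<^sub>R z) - 2) / (2 * t)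
          = q y (2 * t) + q z (2 * t)"
        unfolding q_def add_divide_distrib[symmetric] by simp
      ultimately show "q (y + z) t \<le> q y (2 * t) + q z (2 * t)" by simp
    qed simp
    then show ?thesis
      by (rule tendsto_le[OF _ lim right[OF g], rotated]) simp
  qed
  have neg: "g (- y) = - g y" for y using scale[of "-1" y] by simp
  have add: "g (y + z) = g y + g z" for y z
    using sub[of y z] sub[of "- y" "- z"] neg[of y] neg[of z] neg[of "y + z"] by simp
  have bound: "\<bar>g y\<bar> \<le> norm y" for y
  proof -
    have "\<bar>q y t\<bar> \<le> norm y" if "t \<noteq> 0" for t
      using that norm_triangle_ineq3[of "x + t *\<^sub>R y" x] x
      by (simp add: q_def abs_divide field_simps)
    then have "\<forall>\<^sub>F t in at 0. \<bar>q y t\<bar> \<le> norm y"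
      by (auto simp: eventually_at_filter)
    with tendsto_rabs[OF g] show ?thesis
      by (rule tendsto_upperbound) simp
  qed
  have gx: "g x = 1"
  proof (rule uniq)
    have "q x t = 1" if "t \<noteq> 0" "\<bar>t\<bar> < 1" for t
    proof -
      have "x + t *\<^sub>R x = (1 + t) *\<^sub>R x" by (simp add: algebra_simps)
      then show ?thesis using that x by (simp add: q_def)
    qed
    then have "\<forall>\<^sub>F t in at 0. q x t = 1"
      unfolding eventually_at by (intro exI[of _ 1]) (auto simp: dist_real_def)
    then show "(q x \<longlongrightarrow> 1) (at 0)" by (rule tendsto_eventually)
  qed
  have "bounded_linear g"
    by (rule bounded_linear_intro[where K = 1]) (use add scale bound in auto)
  then have app: "blinfun_apply (Blinfun g) = g" by (rule bounded_linear_Blinfun_apply)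
  have "norm (Blinfun g) \<le> 1"
    by (rule norm_blinfun_bound) (use app bound in auto)
  moreover have "1 \<le> norm (Blinfun g)"
    using norm_blinfun[of "Blinfun g" x] app gx x by simp
  ultimately show ?thesis using app gx by (intro exI[of _ "Blinfun g"]) auto
qed

lemma duality_map_ex1:
  fixes x :: "'a::real_normed_vector"
  assumes sm: "smooth_space TYPE('a)"
  shows "\<exists>!f::'a \<Rightarrow>\<^sub>L real. \<langle>x, f\<rangle> = (norm x)\<^sup>2 \<and> (norm f)\<^sup>2 = (norm x)\<^sup>2"
proof (cases "x = 0")
  case True
  then show ?thesis by auto
next
  case False
  define n where "n = norm x"
  have n: "n > 0" using False by (simp add: n_def)
  define e where "e = x /\<^sub>R n"
  have e: "norm e = 1" using n by (simp add: e_def n_def)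
  have xe: "x = n *\<^sub>R e" using n by (simp add: e_def)
  have key: "(\<langle>x, f\<rangle> = (norm x)\<^sup>2 \<and> (norm f)\<^sup>2 = (norm x)\<^sup>2) \<longleftrightarrow>
      (\<langle>e, f /\<^sub>R n\<rangle> = 1 \<and> norm (f /\<^sub>R n) = 1)" for f :: "'a \<Rightarrow>\<^sub>L real"
  proof -
    have "\<langle>x, f\<rangle> = n\<^sup>2 \<longleftrightarrow> \<langle>e, f /\<^sub>R n\<rangle> = 1"
      using n by (auto simp: e_def blinfun.scaleR_right blinfun.scaleR_left field_simps power2_eq_square)
    moreover have "(norm f)\<^sup>2 = n\<^sup>2 \<longleftrightarrow> norm (f /\<^sub>R n) = 1"
      using n by (auto simp: field_simps power2_eq_iff_nonneg)
    ultimately show ?thesis by (simp add: n_def)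
  qed
  obtain f :: "'a \<Rightarrow>\<^sub>L real" where f: "\<langle>e, f\<rangle> = 1" "norm f = 1"
    using unit_support_exists[OF sm e] by blast
  show ?thesis
  proof (rule ex1I[of _ "n *\<^sub>R f"])
    show "\<langle>x, n *\<^sub>R f\<rangle> = (norm x)\<^sup>2 \<and> (norm (n *\<^sub>R f))\<^sup>2 = (norm x)\<^sup>2"
      unfolding key using f n by simp
  next
    fix h :: "'a \<Rightarrow>\<^sub>L real"
    assume "\<langle>x, h\<rangle> = (norm x)\<^sup>2 \<and> (norm h)\<^sup>2 = (norm x)\<^sup>2"
    then have h: "\<langle>e, h /\<^sub>R n\<rangle> = 1" "norm (h /\<^sub>R n) = 1" unfolding key by auto
    have "h /\<^sub>R n = f"
    proof (rule blinfun_eqI)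
      fix y
      obtain l where "((\<lambda>t. (norm (e + t *\<^sub>R y) - 1) / t) \<longlongrightarrow> l) (at 0)"
        using smooth_space_quotient[OF sm e] by blast
      then show "\<langle>y, h /\<^sub>R n\<rangle> = \<langle>y, f\<rangle>"
        using unit_support_unique[OF e h] unit_support_unique[OF e f] by metis
    qed
    then show "h = n *\<^sub>R f" using n by auto
  qed
qed

lemma duality_map:
  fixes x :: "'a::real_normed_vector"
  assumes "smooth_space TYPE('a)"
  shows "\<langle>x, duality_map x\<rangle> = (norm x)\<^sup>2" and "(norm (duality_map x))\<^sup>2 = (norm x)\<^sup>2"
  using theI'[OF duality_map_ex1[OF assms, of x]] unfolding duality_map_def by auto

end

theory Submission
  imports Defs
begin

text \<open>Write J for \<open>duality_map\<close>. Membership of a in the resolvent at x says that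
  Jx - Ja is \<gamma> times an element u of Aa; likewise Jy - Jb is \<gamma> times some v in Ab.
  Hence Jx - Jy = (Ja - Jb) + \<gamma>(u - v). Pairing with a - b and applying monotonicity at the
  points a and b, not x and y, gives the coefficient 1 + \<gamma>\<alpha>; this is
  \<open>resolvent_monotone\<close>. The rest is this inequality read for the values picked by
  \<open>the_elem\<close>, or for whole graphs.\<close>

lemma resolvent_monotone:
  fixes A :: "'a::real_normed_vector \<Rightarrow> ('a \<Rightarrow>\<^sub>L real) set"
  assumes A: "alpha_monotone \<alpha> A" and \<gamma>: "\<gamma> \<ge> 0"
    and a: "a \<in> resolvent \<gamma> A x" and b: "b \<in> resolvent \<gamma> A y"
  shows "(1 + \<gamma> * \<alpha>) * \<langle>a - b, duality_map a - duality_map b\<rangle>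
    \<le> \<langle>a - b, duality_map x - duality_map y\<rangle>"
proof -
  obtain u where u: "u \<in> A a" "duality_map x = duality_map a + \<gamma> *\<^sub>R u"
    using a by (auto simp: resolvent_def)
  obtain v where v: "v \<in> A b" "duality_map y = duality_map b + \<gamma> *\<^sub>R v"
    using b by (auto simp: resolvent_def)
  have "\<alpha> * \<langle>a - b, duality_map a - duality_map b\<rangle> \<le> \<langle>a - b, u - v\<rangle>"
    using A u(1) v(1) by (auto simp: alpha_monotone_def gra_def)
  then have "\<gamma> * (\<alpha> * \<langle>a - b, duality_map a - duality_map b\<rangle>) \<le> \<gamma> * \<langle>a - b, u - v\<rangle>"
    using \<gamma> by (rule mult_left_mono)
  moreover have "duality_map x - duality_map y
      = (duality_map a - duality_map b) + \<gamma> *\<^sub>R (u - v)"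
    by (simp add: u(2) v(2) scaleR_diff_right)
  then have "\<langle>a - b, duality_map x - duality_map y\<rangle>
      = \<langle>a - b, duality_map a - duality_map b\<rangle> + \<gamma> * \<langle>a - b, u - v\<rangle>"
    \<comment> \<open>Only the outer sum and the scalar are expanded, so the differences stay intact
      and match the monotonicity bound.\<close>
    by (simp only: blinfun.add_left blinfun.scaleR_left real_scaleR_def)
  ultimately show ?thesis by (simp add: distrib_right mult.assoc)
qed

text \<open>\<open>the_elem\<close> is specified only on singletons. A single-valued graph still
  allows empty values, which membership in the domain excludes.\<close>

lemma the_elem_single_valued:
  assumes "single_valued (gra T)" and "x \<in> op_dom T"
  shows "the_elem (T x) \<in> T x"
proof -
  obtain a where "a \<in> T x" using assms(2) by (auto simp: op_dom_def)
  then have "T x = {a}" using assms(1) by (auto simp: single_valued_def gra_def)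
  then show ?thesis by simp
qed

theorem lemma3p15:
  fixes A :: "'a::banach \<Rightarrow> ('a \<Rightarrow>\<^sub>L real) set" and \<alpha> \<gamma> :: real
  assumes "smooth_space TYPE('a)"
    and "alpha_monotone \<alpha> A"
    and "\<gamma> > 0"
  shows "(\<forall>(x, a) \<in> gra (resolvent \<gamma> A). \<forall>(y, b) \<in> gra (resolvent \<gamma> A).
            \<langle>a - b, duality_map x - duality_map y\<rangle>
              \<ge> (1 + \<gamma> * \<alpha>) * \<langle>a - b, duality_map a - duality_map b\<rangle>)
       \<and> (single_valued (gra (resolvent \<gamma> A)) \<longrightarrow>
            (\<forall>x \<in> op_dom (resolvent \<gamma> A). \<forall>y \<in> op_dom (resolvent \<gamma> A).
               \<langle>the_elem (resolvent \<gamma> A x) - the_elem (resolvent \<gamma> A y),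
                  duality_map x - duality_map y\<rangle>
               \<ge> (1 + \<gamma> * \<alpha>) *
                 \<langle>the_elem (resolvent \<gamma> A x) - the_elem (resolvent \<gamma> A y),
                    duality_map (the_elem (resolvent \<gamma> A x))
                      - duality_map (the_elem (resolvent \<gamma> A y))\<rangle>)
            \<and> (1 + \<gamma> * \<alpha> > 0 \<longrightarrow>
                 firmly_nonexpansive_type (1 + \<gamma> * \<alpha>) (resolvent \<gamma> A)))"
proof -
  note mono = resolvent_monotone[OF assms(2) less_imp_le[OF assms(3)]]
  show ?thesis
    unfolding firmly_nonexpansive_type_def
    \<comment> \<open>The rule is unfolded because \<open>gra_def\<close> also rewrites the
      single-valuedness assumption that must match its premise.\<close>
    by (auto simp: gra_def intro!: mono
        the_elem_single_valued[of "resolvent \<gamma> A", unfolded gra_def])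
qed

end
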